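(* For a ring $R$ the following conditions are equivalent: 1. The ring $R$ is a prime rich ring. 2. Every ideal $\mathfrak{a}$ of $R$ contains a finite product of its minimal primes (i.e. of elements of $\min(\mathfrak{a})$). 3. For every ideal $\mathfrak{a}$ of $R$, $|\min(\mathfrak{a})|<\infty$ and the prime radical $\mathfrak{n}_{R/\mathfrak{a}}$ of the factor ring $R/\mathfrak{a}$ is a nilpotent ideal.
   Context: Rings are associative with $1$; "ideal" means two-sided ideal. For an ideal $\mathfrak{a}$ of $R$, $\min(\mathfrak{a})$ denotes the set of minimal primes over $\mathfrak{a}$, i.e. the prime ideals of $R$ that are minimal (under inclusion) among those containing $\mathfrak{a}$. The prime radical $\mathfrak{n}_R$ of a ring $R$ is the intersection of all prime ideals of $R$. A ring is called a prime rich ring if each ideal contains a finite product of prime ideals that contain it. *)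

theory Defs
  imports "HOL-Algebra.Ideal_Product" "HOL-Algebra.QuotRing"
begin

(* Ideals are two-sided, as in HOL-Algebra's locale ideal.  The library's locale primeideal
   includes commutativity and is elementwise, so primeness is defined here by products of
   ideals, the usual notion for rings that need not be commutative. *)
definition prime_ideal :: "'a set \<Rightarrow> ('a, 'm) ring_scheme \<Rightarrow> bool" where
  "prime_ideal P R \<longleftrightarrow> ideal P R \<and> P \<noteq> carrier R \<and>
     (\<forall>I J. ideal I R \<longrightarrow> ideal J R \<longrightarrow> I \<cdot>\<^bsub>R\<^esub> J \<subseteq> P \<longrightarrow> I \<subseteq> P \<or> J \<subseteq> P)"

definition minimal_primes :: "('a, 'm) ring_scheme \<Rightarrow> 'a set \<Rightarrow> 'a set set" where
  "minimal_primes R I = {P. prime_ideal P R \<and> I \<subseteq> P \<and>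
     (\<forall>Q. prime_ideal Q R \<longrightarrow> I \<subseteq> Q \<longrightarrow> Q \<subseteq> P \<longrightarrow> Q = P)}"

(* The intersection with the carrier only matters for the zero ring, which has no prime ideals
   and whose prime radical is therefore the whole ring. *)
definition prime_radical :: "('a, 'm) ring_scheme \<Rightarrow> 'a set" where
  "prime_radical R = carrier R \<inter> \<Inter>{P. prime_ideal P R}"

(* Ordered product of a list of ideals; repetitions are allowed.  The empty product is the
   unit ideal, so that the improper ideal, which lies in no prime ideal, contains a finite
   product of prime ideals that contain it. *)
definition ideal_prod_list :: "('a, 'm) ring_scheme \<Rightarrow> 'a set list \<Rightarrow> 'a set" where
  "ideal_prod_list R Is = foldr (\<lambda>I J. I \<cdot>\<^bsub>R\<^esub> J) Is (carrier R)"

definition nilpotent_ideal :: "'a set \<Rightarrow> ('a, 'm) ring_scheme \<Rightarrow> bool" where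
  "nilpotent_ideal I R \<longleftrightarrow> ideal I R \<and>
     (\<exists>n>0. ideal_prod_list R (replicate n I) = {\<zero>\<^bsub>R\<^esub>})"

definition prime_rich_ring :: "('a, 'm) ring_scheme \<Rightarrow> bool" where
  "prime_rich_ring R \<longleftrightarrow> ring R \<and>
     (\<forall>I. ideal I R \<longrightarrow>
       (\<exists>Ps. (\<forall>P \<in> set Ps. prime_ideal P R \<and> I \<subseteq> P) \<and> ideal_prod_list R Ps \<subseteq> I))"

end

theory Submission
  imports Defs
begin

text \<open>
  Every prime over an ideal \<open>I\<close> contains a minimal prime over \<open>I\<close>, by Zorn's lemma, so the factors
  of a product of primes inside \<open>I\<close> may be shrunk to minimal ones. Conversely, a prime containing
  a product of ideals contains one of the factors, hence a product of minimal primes inside \<open>I\<close>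
  must involve every minimal prime. Let \<open>N\<close> be the intersection of all primes over \<open>I\<close>, which is
  the preimage of the prime radical of \<open>R/I\<close>. If \<open>I\<close> contains a product of \<open>n\<close> primes over \<open>I\<close>, then
  it contains \<open>N\<^sup>n\<close>. Conversely, if there are finitely many minimal primes, then their product is contained
  in \<open>N\<close>, and the \<open>n\<close>-th power of this product lies in \<open>I\<close> as soon as \<open>N\<^sup>n\<close> does.
\<close>

section \<open>Products of lists of ideals\<close>

lemma ideal_prod_mono:
  assumes "I \<subseteq> I'" "J \<subseteq> J'"
  shows "I \<cdot>\<^bsub>R\<^esub> J \<subseteq> I' \<cdot>\<^bsub>R\<^esub> J'"
proof
  fix s assume "s \<in> I \<cdot>\<^bsub>R\<^esub> J"
  then show "s \<in> I' \<cdot>\<^bsub>R\<^esub> J'"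
    by (induction s rule: ideal_prod.induct) (use assms in \<open>auto intro: ideal_prod.intros\<close>)
qed

lemma ideal_prod_list_Nil [simp]: "ideal_prod_list R [] = carrier R"
  by (simp add: ideal_prod_list_def)

lemma ideal_prod_list_Cons [simp]:
  "ideal_prod_list R (I # Is) = I \<cdot>\<^bsub>R\<^esub> ideal_prod_list R Is"
  by (simp add: ideal_prod_list_def)

lemma ideal_prod_list_mono:
  "list_all2 (\<subseteq>) Is Js \<Longrightarrow> ideal_prod_list R Is \<subseteq> ideal_prod_list R Js"
  by (induction rule: list_all2_induct) (simp_all add: ideal_prod_mono)

context ring
begin

text \<open>Makes the empty product neutral on the left, which is the base case for appending
  lists.\<close>

lemma carrier_ideal_prod:
  assumes "ideal I R"
  shows "carrier R \<cdot> I = I"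
proof
  show "carrier R \<cdot> I \<subseteq> I"
    using ideal_prod_inter[OF oneideal assms] by blast
  show "I \<subseteq> carrier R \<cdot> I"
    using ideal_prod.prod[of \<one> "carrier R" _ I R] ideal.Icarr[OF assms] by force
qed

lemma ideal_prod_list_ideal:
  "\<forall>I\<in>set Is. ideal I R \<Longrightarrow> ideal (ideal_prod_list R Is) R"
  by (induction Is) (auto intro: oneideal ideal_prod_is_ideal)

lemma ideal_prod_list_append:
  assumes "\<forall>I\<in>set Is. ideal I R" "\<forall>J\<in>set Js. ideal J R"
  shows "ideal_prod_list R (Is @ Js) = ideal_prod_list R Is \<cdot> ideal_prod_list R Js"
  using assms(1)
  by (induction Is)
    (auto simp: carrier_ideal_prod ideal_prod_assoc ideal_prod_list_ideal assms(2))

text \<open>Lets a power of a product of primes be read again as a product of primes.\<close>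

lemma ideal_prod_list_concat_replicate:
  assumes "\<forall>I\<in>set Is. ideal I R"
  shows "ideal_prod_list R (concat (replicate n Is)) =
         ideal_prod_list R (replicate n (ideal_prod_list R Is))"
  by (induction n) (use assms in \<open>auto simp: ideal_prod_list_append\<close>)

lemma ideal_prod_list_subset_member:
  assumes "\<forall>I\<in>set Is. ideal I R" "J \<in> set Is"
  shows "ideal_prod_list R Is \<subseteq> J"
  using assms
proof (induction Is)
  case (Cons I Is)
  then have "I \<cdot> ideal_prod_list R Is \<subseteq> I \<inter> ideal_prod_list R Is"
    by (intro ideal_prod_inter ideal_prod_list_ideal) auto
  with Cons show ?case
    by auto
qed simp

section \<open>Prime ideals and minimal primes\<close>

lemma prime_ideal_ideal_prod_list:
  assumes P: "prime_ideal P R" and "\<forall>I\<in>set Is. ideal I R" "ideal_prod_list R Is \<subseteq> P"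
  shows "\<exists>I\<in>set Is. I \<subseteq> P"
  using assms(2,3)
proof (induction Is)
  case Nil
  \<comment> \<open>The empty product is the whole ring, which a proper ideal cannot
    contain.\<close>
  have "P \<subseteq> carrier R"
    using P by (auto simp: prime_ideal_def ideal.Icarr)
  with Nil P show ?case
    by (auto simp: prime_ideal_def)
next
  case (Cons I Is)
  then have "I \<subseteq> P \<or> ideal_prod_list R Is \<subseteq> P"
    using P by (simp add: prime_ideal_def ideal_prod_list_ideal)
  with Cons show ?case
    by auto
qed

text \<open>If \<open>I\<close> misses a member \<open>P\<close> and \<open>J\<close> misses a
  member \<open>Q\<close>, then the smaller of \<open>P\<close> and \<open>Q\<close> contains
  neither, although it is prime and contains \<open>I \<cdot> J\<close>.\<close>

lemma prime_ideal_Inter_chain: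
  assumes "C \<noteq> {}" and prime: "\<And>P. P \<in> C \<Longrightarrow> prime_ideal P R"
    and chain: "\<And>P Q. P \<in> C \<Longrightarrow> Q \<in> C \<Longrightarrow> P \<subseteq> Q \<or> Q \<subseteq> P"
  shows "prime_ideal (\<Inter>C) R"
  unfolding prime_ideal_def
proof (intro conjI allI impI)
  have ideal: "ideal P R" "P \<noteq> carrier R" if "P \<in> C" for P
    using prime[OF that] by (auto simp: prime_ideal_def)
  show "ideal (\<Inter>C) R"
    using ideal \<open>C \<noteq> {}\<close> by (intro i_Intersect) auto
  show "\<Inter>C \<noteq> carrier R"
  proof
    assume eq: "\<Inter>C = carrier R"
    obtain P where "P \<in> C"
      using \<open>C \<noteq> {}\<close> by blast
    with eq ideal[of P] show False
      by (auto dest: ideal.Icarr)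
  qed
  fix I J assume IJ: "ideal I R" "ideal J R" "I \<cdot> J \<subseteq> \<Inter>C"
  show "I \<subseteq> \<Inter>C \<or> J \<subseteq> \<Inter>C"
  proof (rule ccontr)
    assume "\<not> ?thesis"
    then obtain P Q where PQ: "P \<in> C" "Q \<in> C" "\<not> I \<subseteq> P" "\<not> J \<subseteq> Q"
      by blast
    have "I \<subseteq> X \<or> J \<subseteq> X" if "X \<in> C" for X
      using prime[OF that] IJ that unfolding prime_ideal_def by blast
    with PQ chain[of P Q] show False
      by blast
  qed
qed

lemma prime_ideal_contains_minimal_prime:
  assumes Q: "prime_ideal Q R" "I \<subseteq> Q"
  obtains P where "P \<in> minimal_primes R I" "P \<subseteq> Q"
proof -
  define A where "A = {P. prime_ideal P R \<and> I \<subseteq> P \<and> P \<subseteq> Q}"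
  \<comment> \<open>Zorn's lemma for sets yields maximal elements, so complements are taken to
    obtain a minimal one.\<close>
  have "\<exists>M\<in>uminus ` A. \<forall>X\<in>uminus ` A. M \<subseteq> X \<longrightarrow> X = M"
  proof (rule subset_Zorn_nonempty)
    show "uminus ` A \<noteq> {}"
      using Q by (auto simp: A_def)
    fix C assume C: "C \<noteq> {}" "subset.chain (uminus ` A) C"
    define D where "D = uminus ` C"
    have D: "D \<subseteq> A" "D \<noteq> {}"
      using C by (auto simp: D_def subset_chain_def)
    have "prime_ideal (\<Inter>D) R"
    proof (rule prime_ideal_Inter_chain)
      show "P \<subseteq> P' \<or> P' \<subseteq> P" if "P \<in> D" "P' \<in> D" for P P'
        using that C(2) unfolding D_def subset_chain_def by blast
    qed (use D in \<open>auto simp: A_def\<close>)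
    with D have "\<Inter>D \<in> A"
      by (auto simp: A_def)
    moreover have "\<Union>C = - \<Inter>D"
      by (auto simp: D_def)
    ultimately show "\<Union>C \<in> uminus ` A"
      by blast
  qed
  then obtain P where "P \<in> A" and min: "\<And>X. X \<in> A \<Longrightarrow> X \<subseteq> P \<Longrightarrow> X = P"
    by auto
  \<comment> \<open>A prime over \<open>I\<close> inside \<open>P\<close> also lies inside
    \<open>Q\<close>, so minimality within \<open>A\<close> is minimality among all primes over
    \<open>I\<close>.\<close>
  then have "P \<in> minimal_primes R I"
    unfolding minimal_primes_def A_def by blast
  with \<open>P \<in> A\<close> show thesis
    using that by (auto simp: A_def)
qed

text \<open>The replacement is made factor by factor, preserving length and order, so that
  monotonicity applies to the noncommutative product.\<close>

lemma replace_by_minimal_primes: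
  assumes "\<forall>P\<in>set Ps. prime_ideal P R \<and> I \<subseteq> P"
  obtains Ms where "set Ms \<subseteq> minimal_primes R I" "list_all2 (\<subseteq>) Ms Ps"
proof -
  have "\<exists>M. M \<in> minimal_primes R I \<and> M \<subseteq> P" if "P \<in> set Ps" for P
    using assms that prime_ideal_contains_minimal_prime by metis
  then obtain m where "\<And>P. P \<in> set Ps \<Longrightarrow> m P \<in> minimal_primes R I \<and> m P \<subseteq> P"
    by metis
  then show thesis
    by (intro that[of "map m Ps"]) (auto simp: list_all2_conv_all_nth)
qed

text \<open>A minimal prime \<open>Q\<close> contains the product, hence some factor
  \<open>P\<close>. From \<open>I \<subseteq> P \<subseteq> Q\<close> minimality gives
  \<open>P = Q\<close>. Finiteness of the set of minimal primes follows.\<close>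

lemma minimal_primes_subset_factors:
  assumes "\<forall>P\<in>set Ps. prime_ideal P R \<and> I \<subseteq> P" "ideal_prod_list R Ps \<subseteq> I"
  shows "minimal_primes R I \<subseteq> set Ps"
proof
  fix Q assume Q: "Q \<in> minimal_primes R I"
  then have "\<exists>P\<in>set Ps. P \<subseteq> Q"
    using assms
    by (intro prime_ideal_ideal_prod_list) (auto simp: minimal_primes_def prime_ideal_def)
  with Q assms(1) show "Q \<in> set Ps"
    unfolding minimal_primes_def by blast
qed

section \<open>The intersection of the primes over an ideal\<close>

definition radical_over :: "'a set \<Rightarrow> 'a set" where
  "radical_over I = carrier R \<inter> \<Inter>{P. prime_ideal P R \<and> I \<subseteq> P}"

lemma radical_over_ideal: "ideal (radical_over I) R"
proof -
  \<comment> \<open>Inserting the carrier keeps the family nonempty even when no prime lies over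
    \<open>I\<close>.\<close>
  have "radical_over I = \<Inter>(insert (carrier R) {P. prime_ideal P R \<and> I \<subseteq> P})"
    by (auto simp: radical_over_def)
  moreover have "ideal \<dots> R"
    by (intro i_Intersect) (auto simp: oneideal prime_ideal_def)
  ultimately show ?thesis
    by simp
qed

lemma radical_over_eq_minimal_primes:
  "radical_over I = carrier R \<inter> \<Inter>(minimal_primes R I)"
proof -
  have "\<exists>M\<in>minimal_primes R I. M \<subseteq> P" if "prime_ideal P R" "I \<subseteq> P" for P
    using prime_ideal_contains_minimal_prime[OF that] by blast
  then have "\<Inter>(minimal_primes R I) \<subseteq> \<Inter>{P. prime_ideal P R \<and> I \<subseteq> P}"
    by blast
  moreover have "\<Inter>{P. prime_ideal P R \<and> I \<subseteq> P} \<subseteq> \<Inter>(minimal_primes R I)"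
    by (rule Inter_anti_mono) (auto simp: minimal_primes_def)
  ultimately show ?thesis
    unfolding radical_over_def by blast
qed

text \<open>Each factor contains \<open>radical_over I\<close>, so the power with
  \<open>length Ps\<close> factors already lies in \<open>I\<close>. The additional factor makes the
  exponent positive, as nilpotency demands, also when \<open>Ps\<close> is empty.\<close>

lemma radical_over_power_subset:
  assumes "\<forall>P\<in>set Ps. prime_ideal P R \<and> I \<subseteq> P" "ideal_prod_list R Ps \<subseteq> I"
  shows "ideal_prod_list R (replicate (Suc (length Ps)) (radical_over I)) \<subseteq> I"
proof -
  let ?N = "radical_over I"
  have "ideal_prod_list R (replicate (Suc (length Ps)) ?N)
      \<subseteq> ideal_prod_list R (replicate (length Ps) ?N)"
    using ideal_prod_inter[of ?N "ideal_prod_list R (replicate (length Ps) ?N)"]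
    by (simp add: radical_over_ideal ideal_prod_list_ideal)
  also have "\<dots> \<subseteq> ideal_prod_list R Ps"
    using assms(1) by (intro ideal_prod_list_mono)
      (auto simp: list_all2_conv_all_nth radical_over_def all_set_conv_all_nth)
  finally show ?thesis
    using assms(2) by simp
qed

lemma minimal_primes_product_subset:
  assumes "finite (minimal_primes R I)"
    and "ideal_prod_list R (replicate n (radical_over I)) \<subseteq> I"
  shows "\<exists>Ps. set Ps \<subseteq> minimal_primes R I \<and> ideal_prod_list R Ps \<subseteq> I"
proof -
  obtain Ms where Ms: "set Ms = minimal_primes R I"
    using finite_list[OF assms(1)] by blast
  then have ideals: "\<forall>M\<in>set Ms. ideal M R"
    by (auto simp: minimal_primes_def prime_ideal_def)
  \<comment> \<open>The product lies in each of its factors, whatever order \<open>Ms\<close> lists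
    them in. Without minimal primes both sides are the carrier.\<close>
  have "ideal_prod_list R Ms \<subseteq> radical_over I"
    unfolding radical_over_eq_minimal_primes Ms[symmetric]
    using ideal_prod_list_subset_member[OF ideals] ideal_prod_list_ideal[OF ideals]
    by (auto simp: ideal.Icarr)
  then have "ideal_prod_list R (replicate n (ideal_prod_list R Ms))
      \<subseteq> ideal_prod_list R (replicate n (radical_over I))"
    by (intro ideal_prod_list_mono) (simp add: list_all2_conv_all_nth)
  with assms(2) have "ideal_prod_list R (concat (replicate n Ms)) \<subseteq> I"
    by (simp add: ideal_prod_list_concat_replicate[OF ideals])
  moreover have "set (concat (replicate n Ms)) \<subseteq> minimal_primes R I"
    using Ms by auto
  ultimately show ?thesis
    by blast
qed

end

section \<open>Images of ideals under a ring homomorphism\<close>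

context ring_hom_ring
begin

lemma image_ideal_prod:
  assumes "ideal I R" "ideal J R"
  shows "h ` (I \<cdot>\<^bsub>R\<^esub> J) = h ` I \<cdot>\<^bsub>S\<^esub> h ` J"
proof
  show "h ` (I \<cdot>\<^bsub>R\<^esub> J) \<subseteq> h ` I \<cdot>\<^bsub>S\<^esub> h ` J"
  proof
    fix y assume "y \<in> h ` (I \<cdot>\<^bsub>R\<^esub> J)"
    then obtain s where "s \<in> I \<cdot>\<^bsub>R\<^esub> J" "y = h s"
      by blast
    from this(1) have "h s \<in> h ` I \<cdot>\<^bsub>S\<^esub> h ` J"
    proof (induction s rule: ideal_prod.induct)
      case (prod i j)
      then show ?case
        using assms by (auto simp: ideal.Icarr intro!: ideal_prod.prod)
    next
      case (sum s t)
      then have "s \<in> carrier R" "t \<in> carrier R"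
        using R.ideal_prod_in_carrier[OF assms] by auto
      with sum show ?case
        by (simp add: ideal_prod.sum)
    qed
    with \<open>y = h s\<close> show "y \<in> h ` I \<cdot>\<^bsub>S\<^esub> h ` J"
      by simp
  qed
  show "h ` I \<cdot>\<^bsub>S\<^esub> h ` J \<subseteq> h ` (I \<cdot>\<^bsub>R\<^esub> J)"
  proof
    fix y assume "y \<in> h ` I \<cdot>\<^bsub>S\<^esub> h ` J"
    then show "y \<in> h ` (I \<cdot>\<^bsub>R\<^esub> J)"
    proof (induction y rule: ideal_prod.induct)
      case (prod i j)
      then obtain a b where ab: "a \<in> I" "b \<in> J" "i = h a" "j = h b"
        by blast
      then have "i \<otimes>\<^bsub>S\<^esub> j = h (a \<otimes>\<^bsub>R\<^esub> b)"
        using assms by (simp add: ideal.Icarr)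
      with ab show ?case
        by (auto intro: ideal_prod.prod)
    next
      case (sum s t)
      then obtain a b where ab: "a \<in> I \<cdot>\<^bsub>R\<^esub> J" "b \<in> I \<cdot>\<^bsub>R\<^esub> J" "s = h a" "t = h b"
        by blast
      then have "s \<oplus>\<^bsub>S\<^esub> t = h (a \<oplus>\<^bsub>R\<^esub> b)"
        using R.ideal_prod_in_carrier[OF assms] by (simp add: subset_iff)
      with ab show ?case
        by (auto intro: ideal_prod.sum)
    qed
  qed
qed

text \<open>Containing zero makes the image nonempty, which turns inclusion in the singleton into
  equality.\<close>

lemma image_eq_zero_iff:
  assumes "X \<subseteq> carrier R" "\<zero>\<^bsub>R\<^esub> \<in> X"
  shows "h ` X = {\<zero>\<^bsub>S\<^esub>} \<longleftrightarrow> X \<subseteq> a_kernel R S h"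
proof -
  have "\<zero>\<^bsub>S\<^esub> \<in> h ` X"
    using assms(2) by (metis hom_zero imageI)
  with assms(1) show ?thesis
    unfolding a_kernel_def' by blast
qed

text \<open>Such an \<open>x\<close> differs from an element of \<open>P\<close> by an element of
  the kernel, and the kernel lies in \<open>P\<close>. Thus an ideal over the kernel is determined
  by its image.\<close>

lemma mem_ideal_if_image_mem:
  assumes P: "ideal P R" "a_kernel R S h \<subseteq> P" and x: "x \<in> carrier R" "h x \<in> h ` P"
  shows "x \<in> P"
proof -
  obtain p where p: "p \<in> P" "h x = h p"
    using x by blast
  have pc: "p \<in> carrier R"
    using p P by (simp add: ideal.Icarr)
  have "h (x \<ominus>\<^bsub>R\<^esub> p) = h x \<ominus>\<^bsub>S\<^esub> h p"
    unfolding a_minus_def by (simp add: x(1) pc)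
  also have "\<dots> = \<zero>\<^bsub>S\<^esub>"
    unfolding p(2) a_minus_def by (rule S.r_neg) (simp add: pc)
  finally have "x \<ominus>\<^bsub>R\<^esub> p \<in> a_kernel R S h"
    unfolding a_kernel_def' by (simp add: x(1) pc)
  with P p have "(x \<ominus>\<^bsub>R\<^esub> p) \<oplus>\<^bsub>R\<^esub> p \<in> P"
    by (meson additive_subgroup.a_closed ideal.axioms(1) subsetD)
  moreover have "(x \<ominus>\<^bsub>R\<^esub> p) \<oplus>\<^bsub>R\<^esub> p = x"
    using x pc by algebra
  ultimately show ?thesis
    by simp
qed

section \<open>Correspondence of primes under a surjective homomorphism\<close>

context
  assumes surj: "h ` carrier R = carrier S"
begin

lemma surj_image_ideal:
  assumes I: "ideal I R"
  shows "ideal (h ` I) S"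
proof (rule idealI)
  show "ring S"
    by (rule S.ring_axioms)
  show "subgroup (h ` I) (add_monoid S)"
    using I by (intro img_is_add_subgroup additive_subgroup.a_subgroup ideal.axioms(1))
  fix a x assume "a \<in> h ` I" "x \<in> carrier S"
  then obtain i r where ir: "i \<in> I" "r \<in> carrier R" "a = h i" "x = h r"
    using surj by blast
  with I have "x \<otimes>\<^bsub>S\<^esub> a = h (r \<otimes>\<^bsub>R\<^esub> i)" "a \<otimes>\<^bsub>S\<^esub> x = h (i \<otimes>\<^bsub>R\<^esub> r)"
    by (simp_all add: ideal.Icarr)
  with I ir show "x \<otimes>\<^bsub>S\<^esub> a \<in> h ` I" "a \<otimes>\<^bsub>S\<^esub> x \<in> h ` I"
    by (simp_all add: ideal.I_l_closed ideal.I_r_closed)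
qed

lemma image_vimage_ideal:
  assumes "ideal I S"
  shows "h ` {r \<in> carrier R. h r \<in> I} = I"
proof -
  have "I \<subseteq> h ` carrier R"
    using ideal.Icarr[OF assms] surj by auto
  then show ?thesis
    by blast
qed

text \<open>Surjectivity handles \<open>n = 0\<close>, where both sides are unit ideals; each
  further factor is a product of images.\<close>

lemma image_ideal_prod_list_replicate:
  assumes "ideal I R"
  shows "ideal_prod_list S (replicate n (h ` I)) = h ` ideal_prod_list R (replicate n I)"
  by (induction n)
    (simp_all add: surj assms image_ideal_prod R.ideal_prod_list_ideal)

text \<open>Ideals \<open>I\<close> and \<open>J\<close> of \<open>R\<close> are pushed forward to
  ideals of \<open>S\<close>, where the product of the images is the image of the product and so
  lies in \<open>Q\<close>.\<close>

lemma prime_ideal_vimage: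
  assumes Q: "prime_ideal Q S"
  shows "prime_ideal {r \<in> carrier R. h r \<in> Q} R" (is "prime_ideal ?P R")
  unfolding prime_ideal_def
proof (intro conjI allI impI)
  have idQ: "ideal Q S"
    using Q by (simp add: prime_ideal_def)
  then show "ideal ?P R"
    by (rule ideal_vimage)
  \<comment> \<open>Otherwise \<open>Q\<close>, being the image of its preimage, would be all of
    \<open>S\<close>.\<close>
  show "?P \<noteq> carrier R"
    using image_vimage_ideal[OF idQ] surj Q by (auto simp: prime_ideal_def)
  fix I J assume IJ: "ideal I R" "ideal J R" "I \<cdot>\<^bsub>R\<^esub> J \<subseteq> ?P"
  then have "h ` I \<cdot>\<^bsub>S\<^esub> h ` J \<subseteq> Q"
    by (auto simp flip: image_ideal_prod)
  then have "h ` I \<subseteq> Q \<or> h ` J \<subseteq> Q"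
    using Q IJ by (simp add: prime_ideal_def surj_image_ideal)
  with IJ show "I \<subseteq> ?P \<or> J \<subseteq> ?P"
    by (auto simp: ideal.Icarr)
qed

lemma prime_ideal_image:
  assumes P: "prime_ideal P R" and ker: "a_kernel R S h \<subseteq> P"
  shows "prime_ideal (h ` P) S"
  unfolding prime_ideal_def
proof (intro conjI allI impI)
  have idP: "ideal P R"
    using P by (simp add: prime_ideal_def)
  then show "ideal (h ` P) S"
    by (rule surj_image_ideal)
  have memP: "x \<in> P" if "x \<in> carrier R" "h x \<in> h ` P" for x
    using mem_ideal_if_image_mem[OF idP ker that] .
  show "h ` P \<noteq> carrier S"
  proof
    assume "h ` P = carrier S"
    then have "carrier R \<subseteq> P"
      using memP by auto
    with P idP show False
      by (auto simp: prime_ideal_def ideal.Icarr)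
  qed
  fix I J assume IJ: "ideal I S" "ideal J S" "I \<cdot>\<^bsub>S\<^esub> J \<subseteq> h ` P"
  define I' J' where "I' = {r \<in> carrier R. h r \<in> I}" and "J' = {r \<in> carrier R. h r \<in> J}"
  have id': "ideal I' R" "ideal J' R"
    using IJ by (simp_all add: I'_def J'_def ideal_vimage)
  have img: "h ` I' = I" "h ` J' = J"
    using IJ by (simp_all add: I'_def J'_def image_vimage_ideal)
  have "h ` (I' \<cdot>\<^bsub>R\<^esub> J') \<subseteq> h ` P"
    using IJ by (simp add: image_ideal_prod[OF id'] img)
  then have "I' \<cdot>\<^bsub>R\<^esub> J' \<subseteq> P"
    using memP R.ideal_prod_in_carrier[OF id'] by blast
  then have "I' \<subseteq> P \<or> J' \<subseteq> P"
    using P id' by (simp add: prime_ideal_def)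
  then show "I \<subseteq> h ` P \<or> J \<subseteq> h ` P"
    using img by blast
qed

text \<open>Images and preimages match the primes of \<open>S\<close> with the primes of
  \<open>R\<close> over the kernel, so the two intersections correspond.\<close>

lemma prime_radical_eq_image: "prime_radical S = h ` R.radical_over (a_kernel R S h)"
proof
  let ?K = "a_kernel R S h"
  show "prime_radical S \<subseteq> h ` R.radical_over ?K"
  proof
    fix y assume y: "y \<in> prime_radical S"
    then obtain x where x: "x \<in> carrier R" "y = h x"
      using surj by (auto simp: prime_radical_def)
    have "x \<in> P" if P: "prime_ideal P R" "?K \<subseteq> P" for P
    proof (rule mem_ideal_if_image_mem[OF _ P(2) x(1)])
      show "ideal P R"
        using P(1) by (simp add: prime_ideal_def)
      show "h x \<in> h ` P"
        using prime_ideal_image[OF P] y unfolding prime_radical_def x(2) by blast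
    qed
    with x show "y \<in> h ` R.radical_over ?K"
      by (auto simp: R.radical_over_def)
  qed
  show "h ` R.radical_over ?K \<subseteq> prime_radical S"
  proof
    fix y assume "y \<in> h ` R.radical_over ?K"
    then obtain x where x: "x \<in> R.radical_over ?K" "y = h x"
      by blast
    have "h x \<in> Q" if Q: "prime_ideal Q S" for Q
    proof -
      have "\<zero>\<^bsub>S\<^esub> \<in> Q"
        using Q by (simp add: prime_ideal_def additive_subgroup.zero_closed ideal.axioms(1))
      then have "?K \<subseteq> {r \<in> carrier R. h r \<in> Q}"
        unfolding a_kernel_def' by auto
      with x prime_ideal_vimage[OF Q] show ?thesis
        unfolding R.radical_over_def by blast
    qed
    with x show "y \<in> prime_radical S"
      by (simp add: prime_radical_def R.radical_over_def)
  qed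
qed

text \<open>A power of the prime radical of \<open>S\<close> is the image of the same power
  upstairs, and it vanishes exactly when that power lies in the kernel.\<close>

lemma nilpotent_prime_radical_iff:
  "nilpotent_ideal (prime_radical S) S \<longleftrightarrow>
   (\<exists>n>0. ideal_prod_list R (replicate n (R.radical_over (a_kernel R S h))) \<subseteq> a_kernel R S h)"
proof -
  let ?K = "a_kernel R S h" and ?N = "R.radical_over (a_kernel R S h)"
  have "ideal_prod_list S (replicate n (h ` ?N)) = {\<zero>\<^bsub>S\<^esub>} \<longleftrightarrow>
        ideal_prod_list R (replicate n ?N) \<subseteq> ?K" for n
  proof -
    have "ideal (ideal_prod_list R (replicate n ?N)) R"
      by (intro R.ideal_prod_list_ideal) (simp add: R.radical_over_ideal)
    then have "ideal_prod_list R (replicate n ?N) \<subseteq> carrier R"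
      "\<zero>\<^bsub>R\<^esub> \<in> ideal_prod_list R (replicate n ?N)"
      by (auto simp: ideal.Icarr additive_subgroup.zero_closed ideal.axioms(1))
    then have "h ` ideal_prod_list R (replicate n ?N) = {\<zero>\<^bsub>S\<^esub>} \<longleftrightarrow>
        ideal_prod_list R (replicate n ?N) \<subseteq> ?K"
      by (rule image_eq_zero_iff)
    then show ?thesis
      by (simp only: image_ideal_prod_list_replicate[OF R.radical_over_ideal])
  qed
  then show ?thesis
    by (simp add: nilpotent_ideal_def prime_radical_eq_image surj_image_ideal R.radical_over_ideal)
qed

end

end

text \<open>This is the preceding criterion for the canonical projection, a surjection with kernel
  \<open>I\<close>.\<close>

lemma (in ring) nilpotent_prime_radical_Quot_iff:
  assumes "ideal I R"
  shows "nilpotent_ideal (prime_radical (R Quot I)) (R Quot I) \<longleftrightarrow>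
    (\<exists>n>0. ideal_prod_list R (replicate n (radical_over I)) \<subseteq> I)"
proof -
  have carrier: "(+>) I ` carrier R = carrier (R Quot I)"
    unfolding FactRing_def A_RCOSETS_def' by auto
  \<comment> \<open>The zero of the quotient is the coset \<open>I\<close> itself, so this computes
    the kernel.\<close>
  have "I +> x = I \<longleftrightarrow> x \<in> I" if "x \<in> carrier R" for x
    using ideal.rcos_const_imp_mem[OF assms that]
      abelian_subgroup.a_rcos_const[OF abelian_subgroupI3[OF ideal.axioms(1)[OF assms]
        is_abelian_group]]
    by blast
  then have "a_kernel R (R Quot I) ((+>) I) = I"
    unfolding a_kernel_def' FactRing_def using ideal.Icarr[OF assms] by auto
  with ring_hom_ring.nilpotent_prime_radical_iff[OF ideal.rcos_ring_hom_ring[OF assms] carrier]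
  show ?thesis
    by simp
qed

theorem proposition1p1:
  fixes R :: "('a, 'm) ring_scheme"
  assumes "ring R"
  shows "(prime_rich_ring R \<longleftrightarrow>
           (\<forall>I. ideal I R \<longrightarrow>
             (\<exists>Ps. set Ps \<subseteq> minimal_primes R I \<and> ideal_prod_list R Ps \<subseteq> I))) \<and>
         (prime_rich_ring R \<longleftrightarrow>
           (\<forall>I. ideal I R \<longrightarrow>
             finite (minimal_primes R I) \<and>
             nilpotent_ideal (prime_radical (R Quot I)) (R Quot I)))"
proof -
  interpret ring R by fact
  \<comment> \<open>The equivalences hold for each ideal separately, so the prime rich condition is
    isolated for a single \<open>I\<close> and quantified only at the end.\<close>
  define rich where "rich I \<longleftrightarrow>
    (\<exists>Ps. (\<forall>P\<in>set Ps. prime_ideal P R \<and> I \<subseteq> P) \<and> ideal_prod_list R Ps \<subseteq> I)" for I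
  have rich_iff_minimal: "rich I \<longleftrightarrow>
    (\<exists>Ps. set Ps \<subseteq> minimal_primes R I \<and> ideal_prod_list R Ps \<subseteq> I)" for I
  proof
    assume "rich I"
    then obtain Ps where Ps: "\<forall>P\<in>set Ps. prime_ideal P R \<and> I \<subseteq> P" "ideal_prod_list R Ps \<subseteq> I"
      unfolding rich_def by blast
    obtain Ms where "set Ms \<subseteq> minimal_primes R I" "list_all2 (\<subseteq>) Ms Ps"
      using replace_by_minimal_primes[OF Ps(1)] .
    with Ps(2) show "\<exists>Ps. set Ps \<subseteq> minimal_primes R I \<and> ideal_prod_list R Ps \<subseteq> I"
      using ideal_prod_list_mono by blast
  qed (auto simp: rich_def minimal_primes_def)
  have rich_iff_nilpotent: "rich I \<longleftrightarrow>
    finite (minimal_primes R I) \<and> nilpotent_ideal (prime_radical (R Quot I)) (R Quot I)"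
    if I: "ideal I R" for I
  proof
    assume "rich I"
    then obtain Ps where Ps: "\<forall>P\<in>set Ps. prime_ideal P R \<and> I \<subseteq> P" "ideal_prod_list R Ps \<subseteq> I"
      unfolding rich_def by blast
    have "finite (minimal_primes R I)"
      using minimal_primes_subset_factors[OF Ps] by (rule finite_subset) simp
    with radical_over_power_subset[OF Ps] show "finite (minimal_primes R I) \<and>
        nilpotent_ideal (prime_radical (R Quot I)) (R Quot I)"
      unfolding nilpotent_prime_radical_Quot_iff[OF I] by blast
  next
    assume "finite (minimal_primes R I) \<and>
        nilpotent_ideal (prime_radical (R Quot I)) (R Quot I)"
    then show "rich I"
      unfolding nilpotent_prime_radical_Quot_iff[OF I] rich_iff_minimal
      using minimal_primes_product_subset by blast
  qed
  have "prime_rich_ring R \<longleftrightarrow> (\<forall>I. ideal I R \<longrightarrow> rich I)"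
    by (simp add: prime_rich_ring_def rich_def ring_axioms)
  then show ?thesis
    using rich_iff_minimal rich_iff_nilpotent by simp
qed

end
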